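(* Let $E_{ij}$, $i<j$, $i,j\in\mathbb{N}$, be independent and identically distributed random variables with values in $[-1,1]$, mean zero, and variance $\sigma^2>0$. For each $n$, let $\tilde{C}=I_n+E$, where $E$ is the symmetric $n\times n$ matrix with zero diagonal and off-diagonal entries $E_{ij}$ ($1\le i<j\le n$), and let $$C^{*}=\arg\min_{C\in\mathcal{E}_n}\|\tilde{C}-C\|_F$$ be the nearest correlation matrix to $\tilde{C}$ in the Frobenius norm. Then $$ \liminf_{n\rightarrow\infty}\frac{\|\tilde{C}-C^{*}\|_F^2}{\|\tilde{C}-I_n\|_F^2}\geq\frac{1}{2}\qquad\text{almost surely}. $$
   Context: $\mathcal{E}_n=\{C\in\mathbb{R}^{n\times n}: C=C',\ C\succeq 0,\ C_{ii}=1 \text{ for all } i\}$ is the set of $n\times n$ correlation matrices and $\|\cdot\|_F$ is the Frobenius norm. *)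

theory Defs
  imports "HOL-Probability.Probability" "Jordan_Normal_Form.Matrix"
begin

definition frob_norm :: "real mat \<Rightarrow> real" where
  "frob_norm A = sqrt (\<Sum>i<dim_row A. \<Sum>j<dim_col A. (A $$ (i, j))\<^sup>2)"

definition psd_mat :: "nat \<Rightarrow> real mat \<Rightarrow> bool" where
  "psd_mat n A \<longleftrightarrow> (\<forall>x\<in>carrier_vec n. scalar_prod x (A *\<^sub>v x) \<ge> 0)"

definition corr_mats :: "nat \<Rightarrow> real mat set" where
  "corr_mats n = {C \<in> carrier_mat n n. transpose_mat C = C \<and> psd_mat n C \<and> (\<forall>i<n. C $$ (i, i) = 1)}"

(* For A in carrier_mat n n the minimiser exists and is unique, since corr_mats n is a nonempty
   compact convex set and the Frobenius norm is Euclidean, so the choice made by arg_min_on is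
   immaterial. *)
definition nearest_corr :: "nat \<Rightarrow> real mat \<Rightarrow> real mat" where
  "nearest_corr n A = arg_min_on (\<lambda>C. frob_norm (A - C)) (corr_mats n)"

(* Only the values e i j with i < j are used. Indices start at 0, as is usual for this
   matrix type. *)
definition sym_noise :: "nat \<Rightarrow> (nat \<Rightarrow> nat \<Rightarrow> real) \<Rightarrow> real mat" where
  "sym_noise n e = mat n n (\<lambda>(i, j). if i < j then e i j else if j < i then e j i else 0)"

definition perturbed_id :: "nat \<Rightarrow> (nat \<Rightarrow> nat \<Rightarrow> real) \<Rightarrow> real mat" where
  "perturbed_id n e = 1\<^sub>m n + sym_noise n e"

end

theory Submission
  imports Defs "HOL-Real_Asymp.Real_Asymp"
begin

text \<open>
  Write \<open>S\<close> for the noise matrix. For a correlation matrix \<open>C\<close>, the trace of \<open>(S - tI) C (S - tI)\<close> is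
  nonnegative, so \<open>2t\<langle>S, C\<rangle> \<le> t\<^sup>2 n + \<langle>S\<^sup>2, C\<rangle>\<close>. Here \<open>\<bar>C\<^sub>j\<^sub>k\<bar> \<le> 1\<close>, the diagonal of \<open>S\<^sup>2\<close>
  contributes at most \<open>n\<^sup>2\<close>, and by Hoeffding's inequality and the Borel-Cantelli lemma the
  off-diagonal entries of \<open>S\<^sup>2\<close> are almost surely eventually at most \<open>\<epsilon>n\<close>. Choosing \<open>t\<close> as a small
  multiple of \<open>n\<close> makes \<open>\<langle>S, C\<rangle>\<close> a small multiple of \<open>n\<^sup>2\<close>, uniformly in \<open>C\<close>, whereas
  the squared norm of \<open>S\<close> is at least \<open>\<sigma>\<^sup>2 n\<^sup>2 / 4\<close> eventually. Since \<open>S\<close> has zero diagonal,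
  the squared distance from \<open>I + S\<close> to \<open>C\<close> is at least the squared norm of \<open>S\<close> minus
  \<open>2\<langle>S, C\<rangle>\<close>, hence at least half of the former.
\<close>

section \<open>Correlation matrices\<close>

text \<open>Test vectors become plain functions on indices: they can be defined by formulas, and the
  condition turns into a family of inequalities linear in the entries of \<open>A\<close>.\<close>

lemma psd_mat_iff:
  assumes "A \<in> carrier_mat n n"
  shows "psd_mat n A \<longleftrightarrow> (\<forall>x. 0 \<le> (\<Sum>i<n. \<Sum>j<n. x i * A $$ (i, j) * x j))"
proof -
  have form: "scalar_prod v (A *\<^sub>v v) = (\<Sum>i<n. \<Sum>j<n. v $ i * A $$ (i, j) * v $ j)"
    if "v \<in> carrier_vec n" for v
    using assms that
    by (auto simp: scalar_prod_def sum_distrib_left lessThan_atLeast0 mult_ac intro!: sum.cong)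
  show ?thesis
  proof (intro iffI allI)
    fix x :: "nat \<Rightarrow> real"
    assume "psd_mat n A"
    then have "0 \<le> scalar_prod (vec n x) (A *\<^sub>v vec n x)"
      by (simp add: psd_mat_def)
    then show "0 \<le> (\<Sum>i<n. \<Sum>j<n. x i * A $$ (i, j) * x j)"
      by (simp add: form)
  next
    assume nonneg: "\<forall>x. 0 \<le> (\<Sum>i<n. \<Sum>j<n. x i * A $$ (i, j) * x j)"
    show "psd_mat n A"
      unfolding psd_mat_def by (intro ballI, subst form, assumption) (rule nonneg[rule_format])
  qed
qed

lemma corr_mats_iff:
  assumes "C \<in> carrier_mat n n"
  shows "C \<in> corr_mats n \<longleftrightarrow>
    (\<forall>i<n. \<forall>j<n. C $$ (i, j) = C $$ (j, i)) \<and> (\<forall>i<n. C $$ (i, i) = 1) \<and>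
    (\<forall>x. 0 \<le> (\<Sum>i<n. \<Sum>j<n. x i * C $$ (i, j) * x j))"
proof -
  have "transpose_mat C = C \<longleftrightarrow> (\<forall>i<n. \<forall>j<n. C $$ (i, j) = C $$ (j, i))"
    using assms by (auto simp: mat_eq_iff)
  then show ?thesis
    using assms psd_mat_iff[OF assms] by (auto simp: corr_mats_def)
qed

text \<open>The quadratic form at the sum of unit vector \<open>i\<close> and \<open>s\<close> times
  unit vector \<open>j\<close> is nonnegative; \<open>s = 1\<close> and \<open>s = -1\<close> give
  the two bounds.\<close>

lemma corr_mats_entry_le_1:
  assumes C: "C \<in> corr_mats n" and "i < n" "j < n"
  shows "\<bar>C $$ (i, j)\<bar> \<le> 1"
proof -
  have carr: "C \<in> carrier_mat n n"
    using C by (simp add: corr_mats_def)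
  note props = C[unfolded corr_mats_iff[OF carr]]
  have sym: "C $$ (j, i) = C $$ (i, j)" and diag: "C $$ (i, i) = 1" "C $$ (j, j) = 1"
    using props assms(2,3) by blast+
  have "0 \<le> 1 + s\<^sup>2 + 2 * s * C $$ (i, j)" for s :: real
  proof -
    \<comment> \<open>As a sum of two indicators, this vector also covers the case
      \<open>i = j\<close>.\<close>
    define x where "x k = of_bool (k = i) + s * of_bool (k = j)" for k
    have pick: "(\<Sum>b<n. f b * x b) = f i + s * f j" for f
      using assms(2,3) by (simp add: x_def algebra_simps sum.distrib flip: sum_distrib_left)
    have "(\<Sum>a<n. \<Sum>b<n. x a * C $$ (a, b) * x b)
        = (\<Sum>a<n. (\<Sum>b<n. C $$ (a, b) * x b) * x a)"
      by (simp add: sum_distrib_left mult_ac)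
    also have "\<dots> = 1 + s\<^sup>2 + 2 * s * C $$ (i, j)"
      by (simp only: pick sym diag) (simp add: algebra_simps power2_eq_square)
    moreover have "0 \<le> (\<Sum>a<n. \<Sum>b<n. x a * C $$ (a, b) * x b)"
      using props by blast
    ultimately show ?thesis
      by simp
  qed
  from this[of 1] this[of "-1"] show ?thesis
    by auto
qed

lemma frob_norm_sq:
  assumes "A \<in> carrier_mat n n"
  shows "(frob_norm A)\<^sup>2 = (\<Sum>i<n. \<Sum>j<n. (A $$ (i, j))\<^sup>2)"
  using assms by (simp add: frob_norm_def sum_nonneg)

lemma one_mat_in_corr_mats: "1\<^sub>m n \<in> corr_mats n"
  by (subst corr_mats_iff[of _ n])
    (auto simp: if_distrib if_distribR sum_nonneg cong: if_cong)

section \<open>Existence of the nearest correlation matrix\<close>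

text \<open>\<open>nearest_corr\<close> is a choice among minimisers, so membership rests on the
  existence of one: a continuous function attains its infimum on a compact set.\<close>

lemma nearest_corr_in_corr_mats:
  assumes A: "A \<in> carrier_mat n n"
  shows "nearest_corr n A \<in> corr_mats n"
proof -
  \<comment> \<open>Matrices are represented by functions on all index pairs, so that Tychonoff's
    theorem makes the cube compact. Outside the \<open>n\<close> by \<open>n\<close> block the
    values are free in the interval.\<close>
  define K :: "(nat \<times> nat \<Rightarrow> real) set"
    where "K = (UNIV \<rightarrow>\<^sub>E {-1..1}) \<inter> {f. mat n n f \<in> corr_mats n}"
  have coord: "continuous_on S (\<lambda>f. f p)"
    for p and S :: "(nat \<times> nat \<Rightarrow> real) set"
    by (rule continuous_on_subset[OF continuous_on_product_coordinates]) simp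
  have "compactin (product_topology (\<lambda>_. euclidean) UNIV)
      (UNIV \<rightarrow>\<^sub>E {-1..1} :: (nat \<times> nat \<Rightarrow> real) set)"
    by (subst compactin_PiE) auto
  then have compact_box: "compact (UNIV \<rightarrow>\<^sub>E {-1..1} :: (nat \<times> nat \<Rightarrow> real) set)"
    by (simp add: euclidean_product_topology)
  have "{f. mat n n f \<in> corr_mats n} =
    {f. (\<forall>i. i < n \<longrightarrow> (\<forall>j. j < n \<longrightarrow> f (i, j) = f (j, i))) \<and> (\<forall>i. i < n \<longrightarrow> f (i, i) = 1) \<and>
      (\<forall>x. 0 \<le> (\<Sum>i<n. \<Sum>j<n. x i * f (i, j) * x j))}"
    by (subst corr_mats_iff) auto
  also have "closed \<dots>"
  proof -
    have "closed {f :: nat \<times> nat \<Rightarrow> real. f (i, j) = f (j, i)}" for i j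
      by (intro closed_Collect_eq coord)
    moreover have "closed {f :: nat \<times> nat \<Rightarrow> real. f (i, i) = 1}" for i
      by (intro closed_Collect_eq coord continuous_on_const)
    moreover have "closed {f. 0 \<le> (\<Sum>i<n. \<Sum>j<n. x i * f (i, j) * x j)}"
      for x :: "nat \<Rightarrow> real"
      by (intro closed_Collect_le continuous_on_sum continuous_on_mult coord continuous_on_const)
    ultimately show ?thesis
      by (intro closed_Collect_conj closed_Collect_all closed_Collect_imp open_Collect_const)
  qed
  finally have "compact K"
    unfolding K_def by (rule compact_Int_closed[OF compact_box])
  define one :: "nat \<times> nat \<Rightarrow> real" where "one = (\<lambda>(i, j). of_bool (i = j))"
  have "mat n n one = 1\<^sub>m n"
    by (auto simp: mat_eq_iff one_def)
  then have "one \<in> K"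
    using one_mat_in_corr_mats by (auto simp: K_def one_def)
  moreover have "continuous_on K (\<lambda>f. frob_norm (A - mat n n f))"
  proof -
    have "frob_norm (A - mat n n f) = sqrt (\<Sum>i<n. \<Sum>j<n. (A $$ (i, j) - f (i, j))\<^sup>2)" for f
      unfolding frob_norm_def by simp
    then show ?thesis
      by (auto intro!: continuous_on_real_sqrt continuous_on_sum continuous_on_power
          continuous_on_diff continuous_on_const coord)
  qed
  ultimately obtain f where f: "f \<in> K"
    "\<And>g. g \<in> K \<Longrightarrow> frob_norm (A - mat n n f) \<le> frob_norm (A - mat n n g)"
    using continuous_attains_inf[OF \<open>compact K\<close>] by blast
  have "frob_norm (A - mat n n f) \<le> frob_norm (A - C)" if C: "C \<in> corr_mats n" for C
  proof -
    have carr: "C \<in> carrier_mat n n"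
      using C by (simp add: corr_mats_def)
    \<comment> \<open>Every correlation matrix is represented in the cube, by the entry bound and
      extension by 0. A minimiser over \<open>K\<close> is therefore one over all of
      \<open>corr_mats n\<close>.\<close>
    define g where "g = (\<lambda>(i, j). if i < n \<and> j < n then C $$ (i, j) else 0)"
    have g: "mat n n g = C"
      using carr by (auto simp: mat_eq_iff g_def)
    have "\<bar>g p\<bar> \<le> 1" for p
      using corr_mats_entry_le_1[OF C] by (cases p) (simp add: g_def)
    then have "g p \<in> {-1..1}" for p
      by (metis abs_le_iff atLeastAtMost_iff minus_le_iff)
    then have "g \<in> K"
      using g C by (auto simp: K_def)
    then show ?thesis
      using f(2) g by metis
  qed
  with f(1) have "is_arg_min (\<lambda>C. frob_norm (A - C)) (\<lambda>C. C \<in> corr_mats n) (mat n n f)"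
    by (auto simp: is_arg_min_linorder K_def)
  then have "is_arg_min (\<lambda>C. frob_norm (A - C)) (\<lambda>C. C \<in> corr_mats n) (nearest_corr n A)"
    unfolding nearest_corr_def arg_min_on_def arg_min_def by (rule someI)
  then show ?thesis
    by (simp add: is_arg_min_def)
qed

section \<open>The deterministic distance bound\<close>

text \<open>Row \<open>i\<close> of \<open>S - t I\<close> serves as test vector for
  \<open>C\<close>; summing over \<open>i\<close> gives a nonnegative trace. The unit diagonal of
  \<open>C\<close> produces the term \<open>t\<^sup>2 * n\<close>, and its symmetry merges the two
  cross terms.\<close>

lemma corr_mats_inner_product_le:
  fixes S :: "nat \<Rightarrow> nat \<Rightarrow> real"
  assumes C: "C \<in> corr_mats n"
  shows "2 * t * (\<Sum>i<n. \<Sum>j<n. S i j * C $$ (i, j)) \<le>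
    t\<^sup>2 * n + (\<Sum>j<n. \<Sum>k<n. (\<Sum>i<n. S i j * S i k) * C $$ (j, k))"
proof -
  have carr: "C \<in> carrier_mat n n"
    using C by (simp add: corr_mats_def)
  note props = C[unfolded corr_mats_iff[OF carr]]
  define x where "x i j = S i j - t * of_bool (j = i)" for i j
  have row: "(\<Sum>j<n. \<Sum>k<n. x i j * C $$ (j, k) * x i k) =
      (\<Sum>j<n. \<Sum>k<n. S i j * S i k * C $$ (j, k)) - 2 * t * (\<Sum>j<n. S i j * C $$ (i, j)) + t\<^sup>2"
    if i: "i < n" for i
  proof -
    have pick: "(\<Sum>k<n. f k * x i k) = (\<Sum>k<n. f k * S i k) - t * f i" for f
      using i by (simp add: x_def algebra_simps sum_subtractf flip: sum_distrib_left)
    have diag: "C $$ (i, i) = 1"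
      using props i by blast
    have sym: "(\<Sum>j<n. S i j * C $$ (j, i)) = (\<Sum>j<n. S i j * C $$ (i, j))"
      using props i by (intro sum.cong) auto
    have "(\<Sum>j<n. \<Sum>k<n. x i j * C $$ (j, k) * x i k) =
        (\<Sum>j<n. (\<Sum>k<n. C $$ (j, k) * x i k) * x i j)"
      by (simp add: sum_distrib_left mult_ac)
    also have "\<dots> = (\<Sum>j<n. ((\<Sum>k<n. C $$ (j, k) * S i k) - t * C $$ (j, i)) * x i j)"
      by (simp only: pick)
    also have "\<dots> = (\<Sum>j<n. ((\<Sum>k<n. C $$ (j, k) * S i k) - t * C $$ (j, i)) * S i j)
        - t * ((\<Sum>k<n. C $$ (i, k) * S i k) - t * C $$ (i, i))"
      by (rule pick)
    also have "\<dots> = (\<Sum>j<n. \<Sum>k<n. S i j * S i k * C $$ (j, k)) -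
        t * (\<Sum>j<n. S i j * C $$ (j, i)) - t * (\<Sum>j<n. S i j * C $$ (i, j)) + t\<^sup>2"
      by (simp add: diag left_diff_distrib right_diff_distrib sum_subtractf sum_distrib_left
          sum_distrib_right power2_eq_square mult_ac)
    finally show ?thesis
      by (simp add: sym)
  qed
  have "0 \<le> (\<Sum>i<n. \<Sum>j<n. \<Sum>k<n. x i j * C $$ (j, k) * x i k)"
  proof (rule sum_nonneg)
    fix i
    show "0 \<le> (\<Sum>j<n. \<Sum>k<n. x i j * C $$ (j, k) * x i k)"
      using props by blast
  qed
  also have "\<dots> = (\<Sum>i<n. \<Sum>j<n. \<Sum>k<n. S i j * S i k * C $$ (j, k)) -
      2 * t * (\<Sum>i<n. \<Sum>j<n. S i j * C $$ (i, j)) + t\<^sup>2 * n"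
    by (simp add: row sum.distrib sum_subtractf sum_distrib_left)
  also have "(\<Sum>i<n. \<Sum>j<n. \<Sum>k<n. S i j * S i k * C $$ (j, k)) =
      (\<Sum>j<n. \<Sum>k<n. (\<Sum>i<n. S i j * S i k) * C $$ (j, k))"
    unfolding sum_distrib_right
    by (subst sum.swap, rule sum.cong[OF refl], rule sum.swap)
  finally show ?thesis
    by simp
qed

text \<open>All that is required of the noise, stated for a fixed \<open>n\<close> without
  probability. The constants are tuned so that the inner product of \<open>S\<close> and
  \<open>C\<close> is at most a quarter of the squared norm of \<open>S\<close>.\<close>

lemma corr_mats_distance_ge:
  fixes S :: "nat \<Rightarrow> nat \<Rightarrow> real"
  assumes C: "C \<in> corr_mats n"
    and diag: "\<And>i. S i i = 0"
    and bounded: "\<And>i j. i < n \<Longrightarrow> j < n \<Longrightarrow> \<bar>S i j\<bar> \<le> 1"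
    and c: "c > 0" and n: "n \<ge> 32 / c\<^sup>2"
    and gram: "\<And>j k. j < n \<Longrightarrow> k < n \<Longrightarrow> j \<noteq> k \<Longrightarrow> \<bar>\<Sum>i<n. S i j * S i k\<bar> \<le> c\<^sup>2 / 64 * n"
    and norm: "c * (real n)\<^sup>2 \<le> (\<Sum>i<n. \<Sum>j<n. (S i j)\<^sup>2)"
  shows "(\<Sum>i<n. \<Sum>j<n. (S i j)\<^sup>2) / 2 \<le> (\<Sum>i<n. \<Sum>j<n. (of_bool (i = j) + S i j - C $$ (i, j))\<^sup>2)"
proof -
  have npos: "n > 0"
    using n c by (cases n) (auto simp: field_simps)
  define I where "I = (\<Sum>i<n. \<Sum>j<n. S i j * C $$ (i, j))"
  \<comment> \<open>One bound for both cases: a diagonal Gram entry is at most \<open>n\<close>, the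
    others obey \<open>gram\<close>.\<close>
  have entry: "(\<Sum>i<n. S i j * S i k) * C $$ (j, k) \<le> of_bool (j = k) * real n + c\<^sup>2 / 64 * n"
    if "j < n" "k < n" for j k
  proof -
    have "\<bar>\<Sum>i<n. S i j * S i j\<bar> \<le> (\<Sum>i<n. 1)"
      using bounded[OF _ \<open>j < n\<close>]
      by (intro order_trans[OF sum_abs] sum_mono)
        (auto simp: abs_square_le_1 simp flip: power2_eq_square)
    then have "\<bar>\<Sum>i<n. S i j * S i k\<bar> \<le> of_bool (j = k) * real n + c\<^sup>2 / 64 * n"
      using gram[OF that] by (cases "j = k") (auto simp: add_increasing2)
    moreover have "\<bar>C $$ (j, k)\<bar> \<le> 1"
      by (rule corr_mats_entry_le_1[OF C that])
    ultimately have "\<bar>(\<Sum>i<n. S i j * S i k) * C $$ (j, k)\<bar> \<le>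
        (of_bool (j = k) * real n + c\<^sup>2 / 64 * n) * 1"
      unfolding abs_mult by (intro mult_mono) auto
    then show ?thesis
      by simp
  qed
  \<comment> \<open>The choice \<open>t = c / 8 * n\<close> makes \<open>t\<^sup>2 * n\<close> equal
    to the total off-diagonal allowance, \<open>c\<^sup>2 / 64\<close> times the cube of
    \<open>n\<close>.\<close>
  have "2 * (c / 8 * n) * I \<le> (c / 8 * n)\<^sup>2 * n +
      (\<Sum>j<n. \<Sum>k<n. (\<Sum>i<n. S i j * S i k) * C $$ (j, k))"
    unfolding I_def by (rule corr_mats_inner_product_le[OF C])
  also have "(\<Sum>j<n. \<Sum>k<n. (\<Sum>i<n. S i j * S i k) * C $$ (j, k)) \<le>
      (\<Sum>j<n. \<Sum>k<n. of_bool (j = k) * real n + c\<^sup>2 / 64 * n)"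
    by (intro sum_mono entry) auto
  also have "\<dots> = (real n)\<^sup>2 + c\<^sup>2 / 64 * (real n)^3"
    by (simp add: sum.distrib power2_eq_square power3_eq_cube algebra_simps
        flip: sum_distrib_right)
  finally have "c / 4 * n * I \<le> c\<^sup>2 / 32 * (real n)^3 + (real n)\<^sup>2"
    by (simp add: power2_eq_square power3_eq_cube algebra_simps)
  \<comment> \<open>The diagonal contribution is of lower order; the threshold
    \<open>32 / c\<^sup>2\<close> absorbs it.\<close>
  moreover have "(real n)\<^sup>2 \<le> c\<^sup>2 / 32 * (real n)^3"
  proof -
    have "1 \<le> c\<^sup>2 / 32 * n"
      using n c by (simp add: field_simps)
    then have "1 * (real n)\<^sup>2 \<le> c\<^sup>2 / 32 * n * (real n)\<^sup>2"
      by (intro mult_right_mono) auto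
    then show ?thesis
      by (simp add: power2_eq_square power3_eq_cube)
  qed
  ultimately have "(c / 4 * n) * I \<le> c\<^sup>2 / 16 * (real n)^3"
    by linarith
  also have "\<dots> = (c / 4 * n) * (c / 4 * (real n)\<^sup>2)"
    by (simp add: power2_eq_square power3_eq_cube)
  finally have "I \<le> c / 4 * (real n)\<^sup>2"
    using c npos by (subst (asm) mult_le_cancel_left_pos) auto
  then have "4 * I \<le> (\<Sum>i<n. \<Sum>j<n. (S i j)\<^sup>2)"
    using norm by linarith
  moreover have "(\<Sum>i<n. \<Sum>j<n. (S i j)\<^sup>2) - 2 * I =
      (\<Sum>i<n. \<Sum>j<n. (S i j)\<^sup>2 - 2 * (S i j * C $$ (i, j)))"
    by (simp add: I_def sum_subtractf sum_distrib_left)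
  moreover have "\<dots> \<le> (\<Sum>i<n. \<Sum>j<n. (of_bool (i = j) + S i j - C $$ (i, j))\<^sup>2)"
  proof (intro sum_mono)
    fix i j :: nat
    \<comment> \<open>The cross term between the identity and \<open>S\<close> vanishes because
      \<open>S\<close> has zero diagonal.\<close>
    have "(of_bool (i = j) + S i j - C $$ (i, j))\<^sup>2 =
        (S i j)\<^sup>2 - 2 * (S i j * C $$ (i, j)) + (of_bool (i = j) - C $$ (i, j))\<^sup>2"
      using diag by (cases "i = j") (auto simp: power2_eq_square algebra_simps)
    then show "(S i j)\<^sup>2 - 2 * (S i j * C $$ (i, j)) \<le> (of_bool (i = j) + S i j - C $$ (i, j))\<^sup>2"
      by simp
  qed
  ultimately show ?thesis
    by linarith
qed

section \<open>Concentration of the noise\<close>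

definition upper_pairs :: "nat \<Rightarrow> (nat \<times> nat) set" where
  "upper_pairs n = {(i, j). i < j \<and> j < n}"

lemma finite_upper_pairs [simp]: "finite (upper_pairs n)"
  by (rule finite_subset[of _ "{..<n} \<times> {..<n}"]) (auto simp: upper_pairs_def)

lemma sum_symmetric_upper_pairs:
  fixes f :: "nat \<Rightarrow> nat \<Rightarrow> real"
  assumes sym: "\<And>i j. f i j = f j i" and diag: "\<And>i. f i i = 0"
  shows "(\<Sum>i<n. \<Sum>j<n. f i j) = 2 * (\<Sum>(i, j)\<in>upper_pairs n. f i j)"
proof (induction n)
  case 0
  then show ?case
    by (simp add: upper_pairs_def)
next
  case (Suc n)
  have "upper_pairs (Suc n) = upper_pairs n \<union> (\<lambda>i. (i, n)) ` {..<n}"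
    by (auto simp: upper_pairs_def less_Suc_eq)
  moreover have "upper_pairs n \<inter> (\<lambda>i. (i, n)) ` {..<n} = {}"
    by (auto simp: upper_pairs_def)
  ultimately have "(\<Sum>(i, j)\<in>upper_pairs (Suc n). f i j) =
      (\<Sum>(i, j)\<in>upper_pairs n. f i j) + (\<Sum>i<n. f i n)"
    by (simp add: sum.union_disjoint sum.reindex inj_on_def)
  moreover have "(\<Sum>j<n. f n j) = (\<Sum>i<n. f i n)"
    by (simp add: sym)
  ultimately show ?case
    using Suc by (simp add: sum.distrib diag)
qed

text \<open>Double counting: the symmetric sum formula is applied to the indicator of
  \<open>i \<noteq> j\<close>.\<close>

lemma card_upper_pairs: "2 * real (card (upper_pairs n)) = real n * (real n - 1)"
proof -
  have "(\<Sum>i<n. \<Sum>j<n. if i = j then 0 else (1::real)) = (\<Sum>i<n. real n - 1)"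
  proof (intro sum.cong refl)
    fix i assume "i \<in> {..<n}"
    then have "(\<Sum>j<n. if i = j then 0 else (1::real)) = (\<Sum>j\<in>{..<n} - {i}. 1)"
      by (intro sum.mono_neutral_cong_right) auto
    with \<open>i \<in> {..<n}\<close> show "(\<Sum>j<n. if i = j then 0 else (1::real)) = real n - 1"
      by (simp add: of_nat_diff)
  qed
  moreover have "(\<Sum>(i, j)\<in>upper_pairs n. if i = j then 0 else (1::real)) = (\<Sum>p\<in>upper_pairs n. 1)"
    by (intro sum.cong) (auto simp: upper_pairs_def)
  ultimately show ?thesis
    using sum_symmetric_upper_pairs[of "\<lambda>i j. if i = j then 0 else 1" n] by simp
qed

lemma (in prob_space) expectation_mult_indep_vars:
  fixes X :: "'i \<Rightarrow> 'a \<Rightarrow> real"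
  assumes "indep_vars (\<lambda>_. borel) X I" and "p \<in> I" "q \<in> I" "p \<noteq> q"
    and "integrable M (X p)" "integrable M (X q)"
  shows "expectation (\<lambda>\<omega>. X p \<omega> * X q \<omega>) = expectation (X p) * expectation (X q)"
proof -
  have "indep_vars (\<lambda>_. borel) X {p, q}"
    using assms by (auto intro: indep_vars_subset)
  then have "expectation (\<lambda>\<omega>. \<Prod>i\<in>{p, q}. X i \<omega>) = (\<Prod>i\<in>{p, q}. expectation (X i))"
    using assms by (intro indep_vars_lebesgue_integral) auto
  with \<open>p \<noteq> q\<close> show ?thesis
    by simp
qed

section \<open>Tail bounds for the noise\<close>

text \<open>These are the entries of \<open>sym_noise\<close>, without the dimension: one infinite
  array serves every \<open>n\<close>.\<close>

definition sym_entry :: "(nat \<Rightarrow> nat \<Rightarrow> real) \<Rightarrow> nat \<Rightarrow> nat \<Rightarrow> real" where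
  "sym_entry e i j = (if i < j then e i j else if j < i then e j i else 0)"

locale bounded_noise = prob_space +
  fixes E :: "nat \<Rightarrow> nat \<Rightarrow> 'a \<Rightarrow> real" and \<sigma> :: real
  assumes indep: "indep_vars (\<lambda>_. borel) (\<lambda>(i, j). E i j) {(i, j). i < j}"
    and range: "\<And>i j \<omega>. i < j \<Longrightarrow> \<omega> \<in> space M \<Longrightarrow> E i j \<omega> \<in> {-1..1}"
    and mean: "\<And>i j. i < j \<Longrightarrow> expectation (E i j) = 0"
    and var: "\<And>i j. i < j \<Longrightarrow> variance (E i j) = \<sigma>\<^sup>2"
begin

abbreviation S :: "'a \<Rightarrow> nat \<Rightarrow> nat \<Rightarrow> real" where
  "S \<omega> \<equiv> sym_entry (\<lambda>i j. E i j \<omega>)"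

lemma E_measurable [measurable]: "i < j \<Longrightarrow> E i j \<in> borel_measurable M"
  using indep by (auto simp: indep_vars_def)

lemma S_measurable [measurable]: "(\<lambda>\<omega>. S \<omega> i j) \<in> borel_measurable M"
  by (cases i j rule: linorder_cases) (auto simp: sym_entry_def)

lemma abs_E_le_1: "i < j \<Longrightarrow> \<omega> \<in> space M \<Longrightarrow> \<bar>E i j \<omega>\<bar> \<le> 1"
  using range[of i j \<omega>] by (auto simp: abs_le_iff)

lemma abs_S_le_1: "\<omega> \<in> space M \<Longrightarrow> \<bar>S \<omega> i j\<bar> \<le> 1"
  by (auto simp: sym_entry_def abs_E_le_1)

lemma integrable_E: "i < j \<Longrightarrow> integrable M (E i j)"
  by (rule integrable_const_bound[where B = 1]) (auto simp: abs_E_le_1)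

text \<open>Hoeffding's inequality for the squares of the \<open>N\<close> independent entries,
  which lie in \<open>[0,1]\<close>, with deviation equal to half the mean
  \<open>\<sigma>\<^sup>2 * N\<close>.\<close>

lemma prob_frobenius_small:
  assumes n: "n \<ge> 2" and "\<sigma>\<^sup>2 > 0"
  shows "prob {\<omega> \<in> space M. (\<Sum>i<n. \<Sum>j<n. (S \<omega> i j)\<^sup>2) \<le> \<sigma>\<^sup>2 / 4 * (real n)\<^sup>2}
    \<le> exp (- (\<sigma>\<^sup>2)\<^sup>2 / 8) ^ n"
proof -
  define P where "P = upper_pairs n"
  define N where "N = real (card P)"
  have N: "2 * N = real n * (real n - 1)"
    unfolding N_def P_def by (rule card_upper_pairs)
  have "real n * real n \<le> real n * (2 * (real n - 1))"
    using n by (intro mult_left_mono) auto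
  then have N_ge: "N \<ge> (real n)\<^sup>2 / 4"
    using N by (simp add: power2_eq_square algebra_simps)
  have "2 * real n \<le> (real n)\<^sup>2"
    using n by (simp add: power2_eq_square)
  then have N_ge': "N \<ge> real n / 2"
    using N_ge by simp
  then have "N > 0"
    using n by linarith
  define X where "X = (\<lambda>(i, j) \<omega>. (E i j \<omega>)\<^sup>2)"
  have "indep_vars (\<lambda>_. borel) (\<lambda>(i, j). E i j) P"
    by (rule indep_vars_subset[OF indep]) (auto simp: P_def upper_pairs_def)
  then have "indep_vars (\<lambda>_. borel) (\<lambda>p \<omega>. ((case p of (i, j) \<Rightarrow> E i j) \<omega>)\<^sup>2) P"
    by (rule indep_vars_compose2[where Y = "\<lambda>_ x. x\<^sup>2"]) simp
  also have "(\<lambda>p \<omega>. ((case p of (i, j) \<Rightarrow> E i j) \<omega>)\<^sup>2) = X"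
    unfolding X_def by (intro ext) (simp split: prod.split)
  finally have X_indep: "indep_vars (\<lambda>_. borel) X P" .
  interpret H: Hoeffding_ineq M P X "\<lambda>_. 0" "\<lambda>_. 1" "\<Sum>p\<in>P. expectation (X p)"
  proof unfold_locales
    fix p assume "p \<in> P"
    then obtain i j where "p = (i, j)" "i < j"
      by (auto simp: P_def upper_pairs_def)
    then show "AE \<omega> in M. X p \<omega> \<in> {0..1}"
      using abs_E_le_1 by (auto simp: X_def abs_square_le_1)
  qed (simp_all add: X_indep, simp add: P_def)
  have "expectation (X p) = \<sigma>\<^sup>2" if "p \<in> P" for p
    using that var mean by (auto simp: P_def upper_pairs_def X_def)
  then have \<mu>: "(\<Sum>p\<in>P. expectation (X p)) = \<sigma>\<^sup>2 * N"
    by (simp add: N_def)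
  have frob: "(\<Sum>i<n. \<Sum>j<n. (S \<omega> i j)\<^sup>2) = 2 * (\<Sum>p\<in>P. X p \<omega>)" for \<omega>
    by (subst sum_symmetric_upper_pairs)
      (auto simp: P_def sym_entry_def X_def upper_pairs_def intro!: sum.cong)
  \<comment> \<open>As each entry occurs twice in the norm, the threshold says that the sum of the
    \<open>X p\<close> is at most \<open>\<sigma>\<^sup>2 / 8\<close> times the square of
    \<open>n\<close>, hence at most half its mean.\<close>
  have "\<sigma>\<^sup>2 * ((real n)\<^sup>2 / 4) \<le> \<sigma>\<^sup>2 * N"
    using N_ge by (intro mult_left_mono) auto
  then have "(\<Sum>p\<in>P. X p \<omega>) \<le> \<sigma>\<^sup>2 * N - \<sigma>\<^sup>2 * N / 2"
    if "(\<Sum>i<n. \<Sum>j<n. (S \<omega> i j)\<^sup>2) \<le> \<sigma>\<^sup>2 / 4 * (real n)\<^sup>2" for \<omega>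
    using that unfolding frob by linarith
  then have "prob {\<omega> \<in> space M. (\<Sum>i<n. \<Sum>j<n. (S \<omega> i j)\<^sup>2) \<le> \<sigma>\<^sup>2 / 4 * (real n)\<^sup>2} \<le>
      prob {\<omega> \<in> space M. (\<Sum>p\<in>P. X p \<omega>) \<le> \<sigma>\<^sup>2 * N - \<sigma>\<^sup>2 * N / 2}"
    by (intro finite_measure_mono) auto
  also have "\<dots> \<le> exp (- 2 * (\<sigma>\<^sup>2 * N / 2)\<^sup>2 / (\<Sum>p\<in>P. (1 - 0)\<^sup>2))"
    using \<open>N > 0\<close> H.Hoeffding_ineq_le[of "\<sigma>\<^sup>2 * N / 2"] unfolding \<mu> by (simp add: N_def)
  also have "- 2 * (\<sigma>\<^sup>2 * N / 2)\<^sup>2 / (\<Sum>p\<in>P. (1 - 0)\<^sup>2) = - ((\<sigma>\<^sup>2)\<^sup>2 / 2 * N)"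
    using \<open>N > 0\<close> by (simp add: N_def[symmetric] power2_eq_square field_simps)
  \<comment> \<open>A deliberately weak estimate: an exponent linear in \<open>n\<close> already
    yields a geometric tail.\<close>
  also have "- ((\<sigma>\<^sup>2)\<^sup>2 / 2 * N) \<le> - ((\<sigma>\<^sup>2)\<^sup>2 / 2 * (real n / 4))"
    using N_ge' n by (intro le_imp_neg_le mult_left_mono) auto
  also have "exp (- ((\<sigma>\<^sup>2)\<^sup>2 / 2 * (real n / 4))) = exp (- (\<sigma>\<^sup>2)\<^sup>2 / 8) ^ n"
    by (simp add: exp_of_nat_mult[symmetric] mult_ac)
  finally show ?thesis
    by simp
qed

text \<open>For fixed \<open>j \<noteq> k\<close>, different \<open>l\<close> outside
  \<open>{j, k}\<close> involve disjoint sets of noise variables. The summands are thus independent,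
  and each is a product of two independent centred variables.\<close>

lemma prob_gram_entry_large:
  fixes \<epsilon> :: real
  assumes n: "n \<ge> 3" and jk: "j < n" "k < n" "j \<noteq> k" and \<epsilon>: "\<epsilon> > 0"
  shows "prob {\<omega> \<in> space M. \<bar>\<Sum>l<n. S \<omega> l j * S \<omega> l k\<bar> \<ge> \<epsilon> * n} \<le> 2 * exp (- \<epsilon>\<^sup>2 / 2) ^ n"
proof -
  \<comment> \<open>The summands at \<open>l = j\<close> and \<open>l = k\<close> contain a diagonal
    entry and vanish.\<close>
  define L where "L = {..<n} - {j, k}"
  define pr where "pr i l = (min i l, max i l)" for i l :: nat
  define X where "X l \<omega> = S \<omega> l j * S \<omega> l k" for l \<omega>
  have S_pr: "S \<omega> l i = (case pr i l of (a, b) \<Rightarrow> E a b) \<omega>" if "i \<noteq> l" for i l \<omega>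
    using that by (auto simp: sym_entry_def pr_def min_def max_def)
  \<comment> \<open>Grouping into blocks preserves independence. The blocks are disjoint:
    \<open>pr j l = pr k l'\<close> would force \<open>l = k\<close> and \<open>l' = j\<close>,
    excluded by \<open>L\<close>.\<close>
  have "indep_vars (\<lambda>l. PiM {pr j l, pr k l} (\<lambda>_. borel))
      (\<lambda>l \<omega>. restrict (\<lambda>p. (case p of (a, b) \<Rightarrow> E a b) \<omega>) {pr j l, pr k l}) L"
    by (rule indep_vars_restrict[OF indep])
      (auto simp: L_def pr_def disjoint_family_on_def min_def max_def split: if_splits)
  then have "indep_vars (\<lambda>_. borel) (\<lambda>l \<omega>.
      (restrict (\<lambda>p. (case p of (a, b) \<Rightarrow> E a b) \<omega>) {pr j l, pr k l}) (pr j l) *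
      (restrict (\<lambda>p. (case p of (a, b) \<Rightarrow> E a b) \<omega>) {pr j l, pr k l}) (pr k l)) L"
    by (rule indep_vars_compose2[where Y = "\<lambda>l f. f (pr j l) * f (pr k l)"]) measurable
  also have "?this \<longleftrightarrow> indep_vars (\<lambda>_. borel) X L"
    by (rule indep_vars_cong) (auto simp: X_def S_pr L_def fun_eq_iff)
  finally have X_indep: "indep_vars (\<lambda>_. borel) X L" .
  have X_bounded: "X l \<omega> \<in> {-1..1}" if "\<omega> \<in> space M" for l \<omega>
  proof -
    have "\<bar>X l \<omega>\<bar> \<le> 1"
      unfolding X_def abs_mult using abs_S_le_1[OF that] by (intro mult_le_one) auto
    then show ?thesis
      by (auto simp: abs_le_iff)
  qed
  interpret H: Hoeffding_ineq M L X "\<lambda>_. -1" "\<lambda>_. 1" "\<Sum>l\<in>L. expectation (X l)"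
    by unfold_locales (use X_indep X_bounded in \<open>auto simp: L_def\<close>)
  have "expectation (X l) = 0" if "l \<in> L" for l
  proof -
    have ne: "j \<noteq> l" "k \<noteq> l"
      using that by (auto simp: L_def)
    have upper: "pr i l \<in> {(a, b). a < b}" if "i \<noteq> l" for i
      using that by (auto simp: pr_def)
    have X_l: "X l = (\<lambda>\<omega>. (case pr j l of (a, b) \<Rightarrow> E a b) \<omega> *
        (case pr k l of (a, b) \<Rightarrow> E a b) \<omega>)"
      unfolding X_def S_pr[OF ne(1)] S_pr[OF ne(2)] ..
    have "expectation (X l) = expectation (case pr j l of (a, b) \<Rightarrow> E a b) *
        expectation (case pr k l of (a, b) \<Rightarrow> E a b)"
      unfolding X_l using upper ne jk
      by (intro expectation_mult_indep_vars[OF indep])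
        (auto simp: pr_def min_def max_def integrable_E split: if_splits)
    also have "expectation (case pr j l of (a, b) \<Rightarrow> E a b) = 0"
      using upper[OF ne(1)] mean by auto
    finally show ?thesis
      by simp
  qed
  then have \<mu>: "(\<Sum>l\<in>L. expectation (X l)) = 0"
    by simp
  have card: "real (card L) = real n - 2"
    using jk n by (simp add: L_def card_Diff_subset of_nat_diff)
  have gram: "(\<Sum>l<n. S \<omega> l j * S \<omega> l k) = (\<Sum>l\<in>L. X l \<omega>)" for \<omega>
    unfolding L_def X_def by (rule sum.mono_neutral_right) (auto simp: sym_entry_def)
  have "prob {\<omega> \<in> space M. \<bar>\<Sum>l<n. S \<omega> l j * S \<omega> l k\<bar> \<ge> \<epsilon> * n} \<le>
      2 * exp (- 2 * (\<epsilon> * n)\<^sup>2 / (\<Sum>l\<in>L. (1 - -1)\<^sup>2))"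
    using H.Hoeffding_ineq_abs_ge[of "\<epsilon> * n"] card n \<epsilon> unfolding \<mu> gram by simp
  also have "- 2 * (\<epsilon> * n)\<^sup>2 / (\<Sum>l\<in>L. (1 - -1)\<^sup>2) = - (\<epsilon>\<^sup>2 / 2 * ((real n)\<^sup>2 / (real n - 2)))"
    using n card by (simp add: field_simps power2_eq_square)
  \<comment> \<open>Only \<open>n - 2\<close> summands occur, so the quotient is at least
    \<open>n\<close>; \<open>n \<ge> 3\<close> keeps its denominator positive.\<close>
  also have "\<dots> \<le> - (\<epsilon>\<^sup>2 / 2 * real n)"
    using n by (intro le_imp_neg_le mult_left_mono) (auto simp: field_simps power2_eq_square)
  also have "exp (- (\<epsilon>\<^sup>2 / 2 * real n)) = exp (- \<epsilon>\<^sup>2 / 2) ^ n"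
    by (simp add: exp_of_nat_mult[symmetric] mult_ac)
  finally show ?thesis
    by simp
qed

section \<open>Almost sure bounds by the Borel-Cantelli lemma\<close>

lemma AE_eventually_frobenius_large:
  assumes "\<sigma>\<^sup>2 > 0"
  shows "AE \<omega> in M. \<forall>\<^sub>F n in sequentially.
    \<sigma>\<^sup>2 / 4 * (real n)\<^sup>2 \<le> (\<Sum>i<n. \<Sum>j<n. (S \<omega> i j)\<^sup>2)"
proof -
  define A where "A n = {\<omega> \<in> space M. (\<Sum>i<n. \<Sum>j<n. (S \<omega> i j)\<^sup>2) \<le> \<sigma>\<^sup>2 / 4 * (real n)\<^sup>2}" for n
  have "summable (\<lambda>n. exp (- (\<sigma>\<^sup>2)\<^sup>2 / 8) ^ n)"
    using assms by (intro summable_geometric) auto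
  then have "summable (\<lambda>n. prob (A n))"
    by (rule summable_comparison_test'[where N = 2])
      (use prob_frobenius_small assms in \<open>auto simp: A_def\<close>)
  then have "AE \<omega> in M. \<forall>\<^sub>F n in sequentially. \<omega> \<in> space M - A n"
    by (intro borel_cantelli_AE1) (auto simp: A_def emeasure_eq_measure)
  then show ?thesis
    by eventually_elim (auto elim!: eventually_mono simp: A_def)
qed

text \<open>A union bound over the pairs \<open>(j, k)\<close> costs a factor of at most the square
  of \<open>n\<close>, which the geometric tail absorbs.\<close>

lemma AE_eventually_gram_small:
  fixes \<epsilon> :: real
  assumes \<epsilon>: "\<epsilon> > 0"
  shows "AE \<omega> in M. \<forall>\<^sub>F n in sequentially. \<forall>j<n. \<forall>k<n. j \<noteq> k \<longrightarrow>
    \<bar>\<Sum>l<n. S \<omega> l j * S \<omega> l k\<bar> \<le> \<epsilon> * n"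
proof -
  define B where "B n = (\<lambda>(j, k). {\<omega> \<in> space M. \<bar>\<Sum>l<n. S \<omega> l j * S \<omega> l k\<bar> \<ge> \<epsilon> * n})" for n
  define J where "J n = {(j, k). j < n \<and> k < n \<and> j \<noteq> k}" for n :: nat
  define A where "A n = (\<Union>p\<in>J n. B n p)" for n
  have B_sets [measurable]: "B n p \<in> events" for n p
    by (cases p) (simp add: B_def)
  have J_sub: "J n \<subseteq> {..<n} \<times> {..<n}" for n
    by (auto simp: J_def)
  then have J_fin [simp]: "finite (J n)" for n
    by (rule finite_subset) simp
  have J_card: "real (card (J n)) \<le> (real n)\<^sup>2" for n
    using card_mono[OF _ J_sub[of n]] by (simp add: power2_eq_square flip: of_nat_mult)
  have A_sets: "A n \<in> events" for n
    by (auto simp: A_def)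
  define q where "q = exp (- \<epsilon>\<^sup>2 / 2)"
  have q: "0 < q" "q < 1"
    using \<epsilon> by (auto simp: q_def)
  have "prob (A n) \<le> 2 * ((real n)\<^sup>2 * q ^ n)" if "n \<ge> 3" for n
  proof -
    have "prob (A n) \<le> (\<Sum>p\<in>J n. prob (B n p))"
      unfolding A_def by (rule measure_UNION_le) auto
    also have "\<dots> \<le> (\<Sum>p\<in>J n. 2 * q ^ n)"
      using prob_gram_entry_large[OF that] \<epsilon>
      by (intro sum_mono) (auto simp: B_def J_def q_def)
    also have "\<dots> \<le> (real n)\<^sup>2 * (2 * q ^ n)"
      using J_card q by (simp add: mult_right_mono)
    finally show ?thesis
      by simp
  qed
  moreover have "summable (\<lambda>n. (real n)\<^sup>2 * q ^ n)"
  proof (rule summable_comparison_test_bigo)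
    show "(\<lambda>n. (real n)\<^sup>2 * q ^ n) \<in> O(\<lambda>n. 1 / (real n)\<^sup>2)"
      using q by real_asymp
    show "summable (\<lambda>n. norm (1 / (real n)\<^sup>2))"
      using inverse_power_summable[of 2, where 'a = real] by (simp add: field_simps)
  qed
  then have "summable (\<lambda>n. 2 * ((real n)\<^sup>2 * q ^ n))"
    by (rule summable_mult)
  ultimately have "summable (\<lambda>n. prob (A n))"
    by (elim summable_comparison_test'[where N = 3]) simp
  then have "AE \<omega> in M. \<forall>\<^sub>F n in sequentially. \<omega> \<in> space M - A n"
    by (intro borel_cantelli_AE1 A_sets) (simp_all add: emeasure_eq_measure)
  then show ?thesis
  proof eventually_elim
    case (elim \<omega>)
    then show ?case
    proof eventually_elim
      case (elim n)
      have "\<omega> \<notin> B n (j, k)" if "j < n" "k < n" "j \<noteq> k" for j k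
        using that elim by (auto simp: A_def J_def)
      then show ?case
        using elim by (auto simp: B_def not_le intro: less_imp_le)
    qed
  qed
qed

end

section \<open>Passage to the limit inferior\<close>

theorem theorem5:
  fixes M :: "'w measure"
    and E :: "nat \<Rightarrow> nat \<Rightarrow> 'w \<Rightarrow> real"
    and \<sigma> :: real
  assumes "prob_space M"
    and indep: "prob_space.indep_vars M (\<lambda>_. borel) (\<lambda>(i, j). E i j) {(i, j). i < j}"
    and ident: "\<And>i j k l. i < j \<Longrightarrow> k < l \<Longrightarrow> distr M borel (E i j) = distr M borel (E k l)"
    and range: "\<And>i j \<omega>. i < j \<Longrightarrow> \<omega> \<in> space M \<Longrightarrow> E i j \<omega> \<in> {-1..1}"
    and mean: "\<And>i j. i < j \<Longrightarrow> prob_space.expectation M (E i j) = 0"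
    and var: "\<And>i j. i < j \<Longrightarrow> prob_space.variance M (E i j) = \<sigma>\<^sup>2"
    and pos: "\<sigma>\<^sup>2 > 0"
  shows "AE \<omega> in M.
    liminf (\<lambda>n.
      let Ct = perturbed_id n (\<lambda>i j. E i j \<omega>);
          Cs = nearest_corr n Ct
      in ereal ((frob_norm (Ct - Cs))\<^sup>2 / (frob_norm (Ct - 1\<^sub>m n))\<^sup>2)) \<ge> ereal (1 / 2)"
proof -
  interpret prob_space M
    by fact
  interpret bounded_noise M E \<sigma>
    by unfold_locales (use indep range mean var in auto)
  \<comment> \<open>This is the constant of the almost sure norm bound; it also fixes the tolerance
    \<open>c\<^sup>2 / 64\<close> for the Gram entries.\<close>
  define c where "c = \<sigma>\<^sup>2 / 4"
  have c: "c > 0"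
    using pos by (simp add: c_def)
  have "AE \<omega> in M. \<forall>\<^sub>F n in sequentially. c * (real n)\<^sup>2 \<le> (\<Sum>i<n. \<Sum>j<n. (S \<omega> i j)\<^sup>2)"
    unfolding c_def by (rule AE_eventually_frobenius_large[OF pos])
  moreover have "AE \<omega> in M. \<forall>\<^sub>F n in sequentially. \<forall>j<n. \<forall>k<n. j \<noteq> k \<longrightarrow>
      \<bar>\<Sum>l<n. S \<omega> l j * S \<omega> l k\<bar> \<le> c\<^sup>2 / 64 * n"
    by (rule AE_eventually_gram_small) (use c in simp)
  ultimately show ?thesis
    using AE_space
  proof eventually_elim
    case (elim \<omega>)
    have "\<forall>\<^sub>F n in sequentially. 32 / c\<^sup>2 \<le> real n"
      using filterlim_real_sequentially by (auto simp: filterlim_at_top)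
    with elim(1,2) have "\<forall>\<^sub>F n in sequentially.
      let Ct = perturbed_id n (\<lambda>i j. E i j \<omega>);
          Cs = nearest_corr n Ct
      in ereal (1 / 2) \<le> ereal ((frob_norm (Ct - Cs))\<^sup>2 / (frob_norm (Ct - 1\<^sub>m n))\<^sup>2)"
    proof eventually_elim
      case (elim n)
      define Ct where "Ct = perturbed_id n (\<lambda>i j. E i j \<omega>)"
      define Cs where "Cs = nearest_corr n Ct"
      define s where "s = (\<Sum>i<n. \<Sum>j<n. (S \<omega> i j)\<^sup>2)"
      have Ct: "Ct \<in> carrier_mat n n"
        by (simp add: Ct_def perturbed_id_def sym_noise_def)
      have Ct_entry: "Ct $$ (i, j) = of_bool (i = j) + S \<omega> i j" if "i < n" "j < n" for i j
        using that by (simp add: Ct_def perturbed_id_def sym_noise_def sym_entry_def)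
      have Cs: "Cs \<in> corr_mats n"
        unfolding Cs_def by (rule nearest_corr_in_corr_mats[OF Ct])
      then have Cs_carrier: "Cs \<in> carrier_mat n n"
        by (simp add: corr_mats_def)
      have "n > 0"
        using elim(3) c by (cases n) (auto simp: field_simps)
      then have "0 < c * (real n)\<^sup>2"
        using c by simp
      \<comment> \<open>The denominator must be positive: division by zero yields 0, which would
        violate the bound \<open>1 / 2\<close>.\<close>
      then have "s > 0"
        using elim(1) by (simp add: s_def)
      have "(frob_norm (Ct - 1\<^sub>m n))\<^sup>2 = s"
        unfolding s_def using Ct
        by (subst frob_norm_sq[of _ n]) (auto simp: Ct_entry intro!: sum.cong)
      moreover have "(frob_norm (Ct - Cs))\<^sup>2 =
          (\<Sum>i<n. \<Sum>j<n. (of_bool (i = j) + S \<omega> i j - Cs $$ (i, j))\<^sup>2)"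
        using Ct Cs_carrier
        by (subst frob_norm_sq[of _ n]) (auto simp: Ct_entry intro!: sum.cong)
      moreover have "s / 2 \<le> (\<Sum>i<n. \<Sum>j<n. (of_bool (i = j) + S \<omega> i j - Cs $$ (i, j))\<^sup>2)"
        unfolding s_def
        by (rule corr_mats_distance_ge[OF Cs _ _ c elim(3) _ elim(1)])
          (use elim(2) abs_S_le_1[OF \<open>\<omega> \<in> space M\<close>] in \<open>auto simp: sym_entry_def\<close>)
      ultimately show ?case
        using \<open>s > 0\<close> unfolding Cs_def Ct_def by (simp add: Let_def field_simps)
    qed
    then show ?case
      unfolding Let_def by (rule Liminf_bounded)
  qed
qed

end
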